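(* Let $\mathcal{M}$ be any infinite structure. There is a family $\{\mathcal{M}_i:i\in\omega\}$ of proper elementary extensions of $\mathcal{M}$ with $\bigcap_{i\in\omega}M_i=M$, such that for every $i$, $\mathcal{M}_i$ is a proper elementary extension of $\mathcal{M}_{i+1}$.
   Context: $M_i$ and $M$ denote the universes of $\mathcal{M}_i$ and $\mathcal{M}$; $\omega$ is the set of non-negative integers. *)

theory Defs
  imports Complex_Main
begin

text \<open>
  A language is given by sets of function and relation symbols with their arities (constants are
  function symbols of arity 0); its symbols need not exhaust the symbol types, so either set may be
  empty. Interpretations of function symbols only matter on tuples of the right length over the
  universe, whereas relations are sets of such tuples.
\<close>

record ('f, 'r) language =
  fun_syms :: "'f set"
  rel_syms :: "'r set"
  fun_arity :: "'f \<Rightarrow> nat"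
  rel_arity :: "'r \<Rightarrow> nat"

record ('f, 'r, 'a) fo_structure =
  universe :: "'a set"
  fun_interp :: "'f \<Rightarrow> 'a list \<Rightarrow> 'a"
  rel_interp :: "'r \<Rightarrow> 'a list set"

definition tuples :: "nat \<Rightarrow> 'a set \<Rightarrow> 'a list set" where
  "tuples n A = {xs. length xs = n \<and> set xs \<subseteq> A}"

definition is_structure ::
  "('f, 'r) language \<Rightarrow> ('f, 'r, 'a) fo_structure \<Rightarrow> bool" where
  "is_structure L M \<longleftrightarrow>
     universe M \<noteq> {} \<and>
     (\<forall>f \<in> fun_syms L. \<forall>xs \<in> tuples (fun_arity L f) (universe M). fun_interp M f xs \<in> universe M) \<and>
     (\<forall>r \<in> rel_syms L. rel_interp M r \<subseteq> tuples (rel_arity L r) (universe M))"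

datatype 'f fo_term = Var nat | App 'f "'f fo_term list"

datatype ('f, 'r) formula =
    Equal "'f fo_term" "'f fo_term"
  | Rel 'r "'f fo_term list"
  | Neg "('f, 'r) formula"
  | Conj "('f, 'r) formula" "('f, 'r) formula"
  | Exists nat "('f, 'r) formula"

fun term_in :: "('f, 'r) language \<Rightarrow> 'f fo_term \<Rightarrow> bool" where
  "term_in L (Var n) \<longleftrightarrow> True"
| "term_in L (App f ts) \<longleftrightarrow>
     f \<in> fun_syms L \<and> length ts = fun_arity L f \<and> (\<forall>t \<in> set ts. term_in L t)"

primrec formula_in :: "('f, 'r) language \<Rightarrow> ('f, 'r) formula \<Rightarrow> bool" where
  "formula_in L (Equal t u) \<longleftrightarrow> term_in L t \<and> term_in L u"
| "formula_in L (Rel r ts) \<longleftrightarrow>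
     r \<in> rel_syms L \<and> length ts = rel_arity L r \<and> (\<forall>t \<in> set ts. term_in L t)"
| "formula_in L (Neg \<phi>) \<longleftrightarrow> formula_in L \<phi>"
| "formula_in L (Conj \<phi> \<psi>) \<longleftrightarrow> formula_in L \<phi> \<and> formula_in L \<psi>"
| "formula_in L (Exists n \<phi>) \<longleftrightarrow> formula_in L \<phi>"

primrec eval_term ::
  "('f, 'r, 'a) fo_structure \<Rightarrow> (nat \<Rightarrow> 'a) \<Rightarrow> 'f fo_term \<Rightarrow> 'a" where
  "eval_term M s (Var n) = s n"
| "eval_term M s (App f ts) = fun_interp M f (map (eval_term M s) ts)"

primrec sat ::
  "('f, 'r, 'a) fo_structure \<Rightarrow> (nat \<Rightarrow> 'a) \<Rightarrow> ('f, 'r) formula \<Rightarrow> bool" where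
  "sat M s (Equal t u) \<longleftrightarrow> eval_term M s t = eval_term M s u"
| "sat M s (Rel r ts) \<longleftrightarrow> map (eval_term M s) ts \<in> rel_interp M r"
| "sat M s (Neg \<phi>) \<longleftrightarrow> \<not> sat M s \<phi>"
| "sat M s (Conj \<phi> \<psi>) \<longleftrightarrow> sat M s \<phi> \<and> sat M s \<psi>"
| "sat M s (Exists n \<phi>) \<longleftrightarrow> (\<exists>a \<in> universe M. sat M (s(n := a)) \<phi>)"

definition substructure ::
  "('f, 'r) language \<Rightarrow> ('f, 'r, 'a) fo_structure \<Rightarrow> ('f, 'r, 'a) fo_structure \<Rightarrow> bool" where
  "substructure L M N \<longleftrightarrow>
     is_structure L M \<and> is_structure L N \<and> universe M \<subseteq> universe N \<and>
     (\<forall>f \<in> fun_syms L. \<forall>xs \<in> tuples (fun_arity L f) (universe M).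
        fun_interp M f xs = fun_interp N f xs) \<and>
     (\<forall>r \<in> rel_syms L. rel_interp M r = rel_interp N r \<inter> tuples (rel_arity L r) (universe M))"

definition elementary_extension ::
  "('f, 'r) language \<Rightarrow> ('f, 'r, 'a) fo_structure \<Rightarrow> ('f, 'r, 'a) fo_structure \<Rightarrow> bool" where
  "elementary_extension L N M \<longleftrightarrow>
     substructure L M N \<and>
     (\<forall>\<phi> s. formula_in L \<phi> \<longrightarrow> range s \<subseteq> universe M \<longrightarrow> (sat M s \<phi> \<longleftrightarrow> sat N s \<phi>))"

definition proper_elementary_extension ::
  "('f, 'r) language \<Rightarrow> ('f, 'r, 'a) fo_structure \<Rightarrow> ('f, 'r, 'a) fo_structure \<Rightarrow> bool" where
  "proper_elementary_extension L N M \<longleftrightarrow>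
     elementary_extension L N M \<and> universe M \<noteq> universe N"

text \<open>
  A type can be too small to hold a proper extension of a structure over it (for instance if the
  universe is the whole type), so extensions are formed over a larger type, into which the
  structure is transported along an injection. The lemmas below confirm that the transported
  structure is an isomorphic copy.
\<close>

definition image_structure ::
  "('a \<Rightarrow> 'b) \<Rightarrow> ('f, 'r, 'a) fo_structure \<Rightarrow> ('f, 'r, 'b) fo_structure" where
  "image_structure h M =
     \<lparr>universe = h ` universe M,
      fun_interp = (\<lambda>f ys. h (fun_interp M f (map (inv_into (universe M) h) ys))),
      rel_interp = (\<lambda>r. map h ` rel_interp M r)\<rparr>"

lemma universe_image_structure: "universe (image_structure h M) = h ` universe M"
  by (simp add: image_structure_def)

lemma fun_interp_image_structure:
  assumes "inj_on h (universe M)" and "set xs \<subseteq> universe M"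
  shows "fun_interp (image_structure h M) f (map h xs) = h (fun_interp M f xs)"
proof -
  have "map (inv_into (universe M) h) (map h xs) = xs"
    using assms by (simp add: list.map_comp map_idI subset_iff)
  then show ?thesis by (simp add: image_structure_def)
qed

lemma rel_interp_image_structure:
  assumes "inj_on h (universe M)" and "is_structure L M" and "r \<in> rel_syms L"
    and "set xs \<subseteq> universe M"
  shows "map h xs \<in> rel_interp (image_structure h M) r \<longleftrightarrow> xs \<in> rel_interp M r"
proof -
  have "ys = xs" if "ys \<in> rel_interp M r" "map h xs = map h ys" for ys
  proof -
    have "set ys \<subseteq> universe M"
      using assms(2,3) that(1) unfolding is_structure_def tuples_def by blast
    then have "inj_on h (set xs \<union> set ys)"
      using assms(1,4) by (meson inj_on_subset Un_least)
    then show ?thesis using that(2) inj_on_map_eq_map by metis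
  qed
  then show ?thesis by (auto simp: image_structure_def)
qed

lemma is_structure_image_structure:
  assumes inj: "inj_on h (universe M)" and M: "is_structure L M"
  shows "is_structure L (image_structure h M)"
proof -
  have "fun_interp (image_structure h M) f ys \<in> h ` universe M"
    if f: "f \<in> fun_syms L" and ys: "ys \<in> tuples (fun_arity L f) (h ` universe M)" for f ys
  proof -
    have "map (inv_into (universe M) h) ys \<in> tuples (fun_arity L f) (universe M)"
      using ys by (auto simp: tuples_def subset_iff intro: inv_into_into)
    then have "fun_interp M f (map (inv_into (universe M) h) ys) \<in> universe M"
      using M f unfolding is_structure_def by blast
    then show ?thesis by (simp add: image_structure_def)
  qed
  moreover have "rel_interp (image_structure h M) r \<subseteq> tuples (rel_arity L r) (h ` universe M)"
    if "r \<in> rel_syms L" for r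
  proof
    fix ys assume "ys \<in> rel_interp (image_structure h M) r"
    then obtain xs where xs: "xs \<in> rel_interp M r" "ys = map h xs"
      by (auto simp: image_structure_def)
    then have "xs \<in> tuples (rel_arity L r) (universe M)"
      using M that unfolding is_structure_def by blast
    then show "ys \<in> tuples (rel_arity L r) (h ` universe M)"
      using xs(2) by (auto simp: tuples_def)
  qed
  ultimately show ?thesis
    using M unfolding is_structure_def universe_image_structure by blast
qed

end

theory Submission
  imports Defs "HOL-Library.Countable"
begin

text \<open>
  Fix a nonprincipal ultrafilter \<open>U\<close> on the natural numbers and iterate the ultrapower of \<open>M\<close> by
  \<open>U\<close> along \<open>\<omega>\<close>: its elements are the functions \<open>f (x\<^sub>0, x\<^sub>1, \<dots>)\<close> into \<open>M\<close> depending on finitely many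
  coordinates, identified when they agree for \<open>U\<close>-almost all \<open>x\<^sub>0\<close>, for \<open>U\<close>-almost all \<open>x\<^sub>1\<close>, and so on.
  Let \<open>M\<^sub>i\<close> consist of the classes of functions that depend only on coordinates \<open>\<ge> i\<close>.
  Los' theorem holds for each \<open>M\<^sub>i\<close>, because Skolem witnesses can be chosen to depend on the same
  coordinates as the parameters; so the \<open>M\<^sub>i\<close> form a descending elementary chain above \<open>M\<close>.
  If \<open>f\<close> depends on coordinates \<open>< n\<close> and \<open>g\<close> on coordinates \<open>\<ge> n\<close> and they agree almost everywhere,
  then freezing the first \<open>n\<close> coordinates at suitable values shows that \<open>g\<close> is almost everywhere
  constant. Hence the intersection of the \<open>M\<^sub>i\<close> is \<open>M\<close>; and since \<open>U\<close> is nonprincipal, the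
  \<open>i\<close>-th coordinate is not almost everywhere constant, which makes all extensions proper.
\<close>

section \<open>Ultrafilters and their iteration\<close>

text \<open>Zorn's lemma gives a minimal element among the nontrivial filters below
  \<open>F\<close>. Minimality makes it an ultrafilter: restricting it to \<open>P\<close> yields
  either \<open>bot\<close>, so that \<open>P\<close> eventually fails, or the same filter, so that
  \<open>P\<close> eventually holds.\<close>

lemma ultrafilter_exists:
  fixes F :: "'i filter"
  assumes "F \<noteq> bot"
  obtains U where "U \<noteq> bot" "U \<le> F" "\<And>P. eventually P U \<or> eventually (\<lambda>x. \<not> P x) U"
proof -
  define A where "A = {U. U \<noteq> bot \<and> U \<le> F}"
  have "\<exists>m\<in>A. \<forall>a\<in>A. m \<ge> a \<longrightarrow> a = m"
  proof (rule predicate_Zorn)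
    show "partial_order_on A (relation_of (\<ge>) A)"
      by (auto simp: partial_order_on_def preorder_on_def refl_on_def trans_def antisym_def
          relation_of_def)
  next
    fix C assume C: "C \<in> Chains (relation_of (\<ge>) A)"
    then have CA: "C \<subseteq> A"
      by (auto simp: Chains_def relation_of_def)
    have tot: "a \<le> b \<or> b \<le> a" if "a \<in> C" "b \<in> C" for a b
      using C that by (auto simp: Chains_def relation_of_def)
    \<comment> \<open>In a chain the infimum of a nonempty finite set is one of its members, hence
      nontrivial; this finite meet property keeps \<open>Inf C\<close> away from
      \<open>bot\<close>.\<close>
    have fin: "Inf X \<noteq> bot \<and> (X \<noteq> {} \<longrightarrow> Inf X \<in> X)" if "finite X" "X \<subseteq> C" for X
      using that
    proof (induction X rule: finite_induct)
      case empty
      have "top \<noteq> (bot :: 'i filter)"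
        using assms top_greatest[of F] by (metis bot_unique)
      then show ?case by simp
    next
      case (insert a X)
      show ?case
      proof (cases "X = {}")
        case True
        then show ?thesis using insert.prems CA by (auto simp: A_def)
      next
        case False
        then have "Inf X \<in> X" using insert by auto
        then have "inf a (Inf X) = a \<or> inf a (Inf X) = Inf X"
          using tot[of a "Inf X"] insert.prems
          by (metis inf_absorb1 inf_absorb2 insert_subset subsetD)
        then show ?thesis
          using \<open>Inf X \<in> X\<close> insert.prems CA by (auto simp: A_def)
      qed
    qed
    show "\<exists>u\<in>A. \<forall>a\<in>C. a \<ge> u"
    proof (cases "C = {}")
      case True
      then show ?thesis using assms by (auto simp: A_def)
    next
      case False
      have "Inf C \<noteq> bot" by (rule Inf_filter_not_bot) (simp add: fin)
      moreover have "Inf C \<le> F" using False CA by (auto simp: A_def intro: Inf_lower2)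
      ultimately show ?thesis by (auto simp: A_def intro!: bexI[of _ "Inf C"] Inf_lower)
    qed
  qed
  then obtain U where U: "U \<noteq> bot" "U \<le> F"
    and max: "\<And>V. V \<noteq> bot \<Longrightarrow> V \<le> F \<Longrightarrow> V \<le> U \<Longrightarrow> V = U"
    by (auto simp: A_def)
  have "eventually P U \<or> eventually (\<lambda>x. \<not> P x) U" for P
  proof (cases "inf U (principal {x. P x}) = bot")
    case True
    then have "eventually (\<lambda>x. False) (inf U (principal {x. P x}))"
      by simp
    then show ?thesis by (simp add: eventually_inf_principal)
  next
    case False
    then have "inf U (principal {x. P x}) = U"
      using U by (intro max) (auto intro: le_infI1)
    moreover have "eventually P (inf U (principal {x. P x}))"
      by (simp add: eventually_inf_principal)
    ultimately show ?thesis by simp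
  qed
  then show ?thesis using U that by blast
qed

section \<open>Supports of functions on sequences, and the iterated quantifier\<close>

definition determined_by :: "((nat \<Rightarrow> 'n) \<Rightarrow> 'b) \<Rightarrow> nat set \<Rightarrow> bool" where
  "determined_by f S \<longleftrightarrow> (\<forall>x y. (\<forall>k\<in>S. x k = y k) \<longrightarrow> f x = f y)"

lemma determined_byD: "determined_by f S \<Longrightarrow> (\<And>k. k \<in> S \<Longrightarrow> x k = y k) \<Longrightarrow> f x = f y"
  by (auto simp: determined_by_def)

lemma determined_by_mono: "determined_by f S \<Longrightarrow> S \<subseteq> T \<Longrightarrow> determined_by f T"
  unfolding determined_by_def by blast

text \<open>Rule for \<open>monos\<close>: it lets \<open>almost_all\<close> recurse under
  \<open>eventually\<close>.\<close>

lemma eventually_mono_imp: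
  "(\<And>x. P x \<longrightarrow> Q x) \<Longrightarrow> eventually P F \<longrightarrow> eventually Q F"
  by (auto elim: eventually_mono)

text \<open>
  \<open>almost_all U P n x\<close> is the iterated quantifier
  \<open>U a\<^sub>n. U a\<^sub>n\<^sub>+\<^sub>1. \<dots> P (x\<^sub>0, \<dots>, x\<^sub>n\<^sub>-\<^sub>1, a\<^sub>n, a\<^sub>n\<^sub>+\<^sub>1, \<dots>)\<close>, read as a well-founded game:
  finitely many of the quantifiers settle \<open>P\<close>.
\<close>
inductive almost_all :: "'n filter \<Rightarrow> ((nat \<Rightarrow> 'n) \<Rightarrow> bool) \<Rightarrow> nat \<Rightarrow> (nat \<Rightarrow> 'n) \<Rightarrow> bool"
  for U :: "'n filter" and P :: "(nat \<Rightarrow> 'n) \<Rightarrow> bool" where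
  now: "(\<And>y. (\<forall>k<n. y k = x k) \<Longrightarrow> P y) \<Longrightarrow> almost_all U P n x"
| later: "eventually (\<lambda>a. almost_all U P (Suc n) (x(n := a))) U \<Longrightarrow> almost_all U P n x"
monos eventually_mono_imp

lemma almost_all_local_mono:
  assumes "almost_all U P n x" and "\<forall>y. (\<forall>k<n. y k = x k) \<longrightarrow> P y \<longrightarrow> Q y"
  shows "almost_all U Q n x"
  using assms
proof (induction rule: almost_all.induct)
  case (now n x)
  then show ?case by (intro almost_all.now) blast
next
  case (later n x)
  have PQ: "\<forall>y. (\<forall>k<Suc n. y k = (x(n := a)) k) \<longrightarrow> P y \<longrightarrow> Q y" for a
    using later.prems by (auto simp: less_Suc_eq all_conj_distrib)
  show ?case
    by (rule almost_all.later, rule eventually_mono[OF later.IH]) (use PQ in blast)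
qed

lemma almost_all_conj:
  assumes "almost_all U P n x" and "almost_all U Q n x"
  shows "almost_all U (\<lambda>y. P y \<and> Q y) n x"
  using assms
proof (induction rule: almost_all.induct)
  case (now n x)
  then show ?case by (auto intro: almost_all_local_mono[of U Q])
next
  case (later n x)
  from later.prems show ?case
  proof cases
    case now
    \<comment> \<open>\<open>Q\<close> already holds at every continuation of \<open>x\<close>, so
      only \<open>P\<close> remains to be settled.\<close>
    have "almost_all U P n x"
      using later.IH by (intro almost_all.later) (auto elim: eventually_mono)
    with now show ?thesis by (auto intro: almost_all_local_mono[of U P])
  next
    case later': later
    show ?thesis
      by (rule almost_all.later, rule eventually_mono[OF eventually_conj[OF later.IH later']]) blast
  qed
qed

text \<open>Over a nontrivial filter every quantifier has a witness; following the witnesses ends at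
  a point of \<open>P\<close>.\<close>

lemma almost_all_exists:
  assumes "U \<noteq> bot" "almost_all U P n x"
  shows "\<exists>y. (\<forall>k<n. y k = x k) \<and> P y"
  using assms(2)
proof (induction rule: almost_all.induct)
  case (later n x)
  then obtain a where "\<exists>y. (\<forall>k<Suc n. y k = (x(n := a)) k) \<and> P y"
    using eventually_happens'[OF assms(1)] by blast
  then show ?case by (auto simp: less_Suc_eq all_conj_distrib)
qed auto

text \<open>Freezes the coordinates from \<open>k\<close> to \<open>n - 1\<close> at witnesses of
  their quantifiers; a game settled before stage \<open>n\<close> is still settled at stage
  \<open>n\<close>.\<close>

lemma almost_all_instantiate:
  assumes "U \<noteq> bot" "almost_all U P k x" "k \<le> n"
  shows "\<exists>y. almost_all U P n y"
  using assms(2,3)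
proof (induction rule: almost_all.induct)
  case (now k x)
  then show ?case by (intro exI[of _ x] almost_all.now) auto
next
  case (later k x)
  show ?case
  proof (cases "k = n")
    case True
    then show ?thesis
      using later.IH by (intro exI[of _ x] almost_all.later) (auto elim: eventually_mono)
  next
    case False
    then show ?thesis
      using later eventually_happens'[OF assms(1) later.IH] by auto
  qed
qed

text \<open>Coordinates below \<open>n\<close> do not influence \<open>P\<close>, so their frozen
  values can be exchanged; only the values frozen from \<open>n\<close> on must be kept.\<close>

lemma almost_all_tail_cong:
  assumes "almost_all U P m x" "determined_by P {n..}" "n \<le> m" "\<forall>k\<in>{n..<m}. z k = x k"
  shows "almost_all U P m z"
  using assms(1,3,4)
proof (induction arbitrary: z rule: almost_all.induct)
  case (now m x)
  show ?case
  proof (rule almost_all.now)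
    fix y assume y: "\<forall>k<m. y k = z k"
    \<comment> \<open>The splice of the old prefix with \<open>y\<close> is a continuation of
      \<open>x\<close>, because \<open>y\<close>, \<open>z\<close> and \<open>x\<close> agree on
      \<open>{n..<m}\<close>.\<close>
    have "P (\<lambda>k. if k < n then x k else y k)"
      using now y by auto
    then show "P y"
      using determined_byD[OF assms(2), of y "\<lambda>k. if k < n then x k else y k"] by auto
  qed
next
  case (later m x)
  have "\<forall>k\<in>{n..<Suc m}. (z(m := a)) k = (x(m := a)) k" for a
    using later.prems by auto
  then show ?case
    using later by (intro almost_all.later) (auto elim!: eventually_mono)
qed

text \<open>A condition true for all values is true for almost all, so the quantifiers over
  coordinates \<open>k\<close> to \<open>n - 1\<close> can be put in front.\<close>

lemma almost_all_from_start:
  assumes "\<And>z. almost_all U P n z" "k \<le> n"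
  shows "almost_all U P k z"
  using assms(2)
proof (induction arbitrary: z rule: inc_induct)
  case base
  then show ?case by (rule assms)
next
  case (step k)
  then show ?case by (auto intro: almost_all.later)
qed

text \<open>Induction on the number of support coordinates still open: from stage \<open>m\<close>
  on the truth value of \<open>P\<close> is fixed, and before that the ultrafilter chooses between
  the two outcomes of the next stage.\<close>

lemma almost_all_decides:
  assumes U: "\<And>R. eventually R U \<or> eventually (\<lambda>a. \<not> R a) U"
    and P: "determined_by P {..<m}"
  shows "almost_all U P n x \<or> almost_all U (\<lambda>y. \<not> P y) n x"
proof (induction "m - n" arbitrary: n x)
  case 0
  then have "P y = P x" if "\<forall>k<n. y k = x k" for y
    using that by (intro determined_byD[OF P]) auto
  then show ?case
    using almost_all.now[of n x P U] almost_all.now[of n x "\<lambda>y. \<not> P y" U] by blast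
next
  case (Suc d)
  have "almost_all U P (Suc n) y \<or> almost_all U (\<lambda>y. \<not> P y) (Suc n) y" for y
    using Suc by (intro Suc.hyps) auto
  then have "eventually (\<lambda>a. almost_all U (\<lambda>y. \<not> P y) (Suc n) (x(n := a))) U"
    if "\<not> eventually (\<lambda>a. almost_all U P (Suc n) (x(n := a))) U"
    using that U[of "\<lambda>a. almost_all U P (Suc n) (x(n := a))"]
    by (smt (verit) eventually_mono)
  then show ?case by (blast intro: almost_all.later)
qed

text \<open>A Fubini power of \<open>U\<close> of length \<omega>, whose large sets are those won
  from stage 0. The point \<open>x\<close> is only a formal start, since stage 0 freezes no
  coordinate.\<close>

definition iterated_filter :: "'n filter \<Rightarrow> (nat \<Rightarrow> 'n) filter" where
  "iterated_filter U = Abs_filter (\<lambda>P. \<forall>x. almost_all U P 0 x)"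

lemma eventually_iterated_filter:
  "eventually P (iterated_filter U) \<longleftrightarrow> (\<forall>x. almost_all U P 0 x)"
  unfolding iterated_filter_def
proof (rule eventually_Abs_filter, unfold_locales)
  show "\<forall>x. almost_all U (\<lambda>x. True) 0 x" by (auto intro: almost_all.now)
  show "\<forall>x. almost_all U (\<lambda>x. P x \<and> Q x) 0 x"
    if "\<forall>x. almost_all U P 0 x" "\<forall>x. almost_all U Q 0 x" for P Q
    using that by (blast intro: almost_all_conj)
  show "\<forall>x. almost_all U Q 0 x"
    if "\<forall>x. P x \<longrightarrow> Q x" "\<forall>x. almost_all U P 0 x" for P Q
    using that by (blast intro: almost_all_local_mono)
qed

lemma eventually_iterated_filterI:
  assumes "almost_all U P 0 x"
  shows "eventually P (iterated_filter U)"
  unfolding eventually_iterated_filter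
proof
  have "determined_by P {0..}"
    by (auto simp: determined_by_def simp flip: fun_eq_iff)
  then show "almost_all U P 0 z" for z
    using almost_all_tail_cong[OF assms] by auto
qed

lemma iterated_filter_neq_bot: "U \<noteq> bot \<Longrightarrow> iterated_filter U \<noteq> bot"
  using almost_all_exists[of U "\<lambda>_. False"]
  by (auto simp: trivial_limit_def eventually_iterated_filter)

lemma iterated_filter_decides:
  assumes "\<And>R. eventually R U \<or> eventually (\<lambda>a. \<not> R a) U" and "determined_by P {..<m}"
  shows "eventually P (iterated_filter U) \<or> eventually (\<lambda>y. \<not> P y) (iterated_filter U)"
  using almost_all_decides[OF assms] by (blast intro: eventually_iterated_filterI)

lemma iterated_filter_disjoint_supports:
  assumes "U \<noteq> bot" "eventually (\<lambda>x. f x = g x) (iterated_filter U)"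
    and f: "determined_by f {..<n}" and g: "determined_by g {n..}"
  shows "\<exists>y. eventually (\<lambda>x. g x = f y) (iterated_filter U)"
proof -
  obtain y where "almost_all U (\<lambda>x. f x = g x) n y"
    using almost_all_instantiate[OF assms(1)] assms(2)[unfolded eventually_iterated_filter]
    by (metis le0)
  then have y: "almost_all U (\<lambda>x. g x = f y) n y"
    by (rule almost_all_local_mono) (metis determined_byD[OF f] lessThan_iff)
  have "determined_by (\<lambda>x. g x = f y) {n..}"
    using g unfolding determined_by_def by metis
  then have "almost_all U (\<lambda>x. g x = f y) n z" for z
    using almost_all_tail_cong[OF y] by auto
  then show ?thesis
    using almost_all_from_start[of U _ n 0] by (auto simp: eventually_iterated_filter)
qed

text \<open>When coordinate \<open>i\<close> comes up, almost every value differs from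
  \<open>c\<close>; playing such a value refutes the claim, whether the game stops or goes
  on.\<close>

lemma iterated_filter_coordinate_not_const:
  assumes "U \<noteq> bot" "eventually (\<lambda>a. a \<noteq> c) U"
  shows "\<not> eventually (\<lambda>x. x i = c) (iterated_filter U)"
proof
  assume "eventually (\<lambda>x. x i = c) (iterated_filter U)"
  then obtain y where "almost_all U (\<lambda>x. x i = c) i y"
    using almost_all_instantiate[OF assms(1)] by (metis le0 eventually_iterated_filter)
  then show False
  proof cases
    case now
    obtain a where "a \<noteq> c" using eventually_happens'[OF assms] by blast
    then show ?thesis using now[of "y(i := a)"] by auto
  next
    case later
    obtain a where "a \<noteq> c" "almost_all U (\<lambda>x. x i = c) (Suc i) (y(i := a))"
      using eventually_happens'[OF assms(1) eventually_conj[OF assms(2) later]] by blast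
    then show ?thesis using almost_all_exists[OF assms(1)] by fastforce
  qed
qed

section \<open>Limit ultrapowers\<close>

lemma eval_term_finite_support:
  "\<exists>K. \<forall>s s'. (\<forall>k<K. s k = s' k) \<longrightarrow> eval_term M s t = eval_term M s' t"
proof (induction t)
  case (Var n)
  then show ?case by (intro exI[of _ "Suc n"]) auto
next
  case (App f ts)
  then obtain K where K: "\<And>t s s'. t \<in> set ts \<Longrightarrow> (\<forall>k<K t. s k = s' k) \<Longrightarrow>
      eval_term M s t = eval_term M s' t"
    by metis
  \<comment> \<open>If \<open>ts\<close> is empty the maximum is unspecified, but then both lists
    are empty.\<close>
  have "map (eval_term M s) ts = map (eval_term M s') ts"
    if "\<forall>k<Max (K ` set ts). s k = s' k" for s s'
    using that by (auto intro!: K simp: less_le_trans)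
  then show ?case by (intro exI[of _ "Max (K ` set ts)"]) (metis eval_term.simps(2))
qed

lemma map_eval_term_finite_support:
  "\<exists>K. \<forall>s s'. (\<forall>k<K. s k = s' k) \<longrightarrow> map (eval_term M s) ts = map (eval_term M s') ts"
proof (induction ts)
  case (Cons t ts)
  then obtain K where K: "\<And>s s'. (\<forall>k<K. s k = s' k) \<Longrightarrow> map (eval_term M s) ts = map (eval_term M s') ts"
    by blast
  obtain K' where "\<And>s s'. (\<forall>k<K'. s k = s' k) \<Longrightarrow> eval_term M s t = eval_term M s' t"
    using eval_term_finite_support by blast
  with K show ?case by (intro exI[of _ "max K K'"]) (simp add: less_max_iff_disj)
qed auto

text \<open>The bound is an initial segment of the variables, so that an assignment can be replaced
  by the list of its first \<open>K\<close> values; Skolem witnesses thus become functions of finite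
  lists.\<close>

lemma sat_finite_support:
  "\<exists>K. \<forall>s s'. (\<forall>k<K. s k = s' k) \<longrightarrow> sat M s \<phi> = sat M s' \<phi>"
proof (induction \<phi>)
  case (Equal t u)
  obtain K K' where "\<And>s s'. (\<forall>k<K. s k = s' k) \<Longrightarrow> eval_term M s t = eval_term M s' t"
    "\<And>s s'. (\<forall>k<K'. s k = s' k) \<Longrightarrow> eval_term M s u = eval_term M s' u"
    using eval_term_finite_support by metis
  then show ?case
    by (intro exI[of _ "max K K'"]) (simp add: less_max_iff_disj, metis)
next
  case (Rel r ts)
  obtain K where "\<And>s s'. (\<forall>k<K. s k = s' k) \<Longrightarrow> map (eval_term M s) ts = map (eval_term M s') ts"
    using map_eval_term_finite_support by blast
  then show ?case
    unfolding sat.simps by (intro exI[of _ K]) metis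
next
  case (Neg \<phi>)
  then show ?case by simp
next
  case (Conj \<phi> \<psi>)
  then obtain K K' where K: "\<And>s s'. (\<forall>k<K. s k = s' k) \<Longrightarrow> sat M s \<phi> = sat M s' \<phi>"
    and K': "\<And>s s'. (\<forall>k<K'. s k = s' k) \<Longrightarrow> sat M s \<psi> = sat M s' \<psi>"
    by metis
  have "sat M s (Conj \<phi> \<psi>) = sat M s' (Conj \<phi> \<psi>)" if "\<forall>k<max K K'. s k = s' k" for s s'
    using K[of s s'] K'[of s s'] that by (auto simp: less_max_iff_disj)
  then show ?case by blast
next
  case (Exists n \<phi>)
  then obtain K where K: "\<And>s s'. (\<forall>k<K. s k = s' k) \<Longrightarrow> sat M s \<phi> = sat M s' \<phi>"
    by blast
  have "sat M (s(n := a)) \<phi> = sat M (s'(n := a)) \<phi>" if "\<forall>k<K. s k = s' k" for s s' a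
    using that by (intro K) auto
  then show ?case unfolding sat.simps by (intro exI[of _ K]) metis
qed

lemma sat_image_structure:
  assumes h: "inj_on h (universe M)" and M: "is_structure L M"
    and "formula_in L \<phi>" "range s \<subseteq> universe M"
  shows "sat (image_structure h M) (\<lambda>k. h (s k)) \<phi> \<longleftrightarrow> sat M s \<phi>"
proof -
  \<comment> \<open>Membership in the universe is part of the induction because \<open>h\<close> is
    known to be injective only there.\<close>
  have eval: "eval_term M s t \<in> universe M \<and>
      eval_term (image_structure h M) (\<lambda>k. h (s k)) t = h (eval_term M s t)"
    if "range s \<subseteq> universe M" "term_in L t" for s t
    using that(2)
  proof (induction t)
    case (Var n)
    then show ?case using that(1) by auto
  next
    case (App f ts)
    then have IH: "set (map (eval_term M s) ts) \<subseteq> universe M"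
      "map (eval_term (image_structure h M) (\<lambda>k. h (s k))) ts = map h (map (eval_term M s) ts)"
      by auto
    have "fun_interp M f (map (eval_term M s) ts) \<in> universe M"
      using M App.prems IH(1) by (auto simp: is_structure_def tuples_def)
    then show ?case
      using fun_interp_image_structure[OF h IH(1)] IH(2) by (simp del: map_map map_eq_conv)
  qed
  show ?thesis
    using assms(3,4)
  proof (induction \<phi> arbitrary: s)
    case (Equal t u)
    then show ?case using eval[of s t] eval[of s u] inj_on_eq_iff[OF h] by auto
  next
    case (Rel r ts)
    then have "map (eval_term (image_structure h M) (\<lambda>k. h (s k))) ts = map h (map (eval_term M s) ts)"
      "set (map (eval_term M s) ts) \<subseteq> universe M"
      using eval by auto
    then show ?case
      using rel_interp_image_structure[OF h M, of r "map (eval_term M s) ts"] Rel.prems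
      by (simp del: map_map map_eq_conv)
  next
    case (Exists n \<phi>)
    have "sat (image_structure h M) ((\<lambda>k. h (s k))(n := h a)) \<phi> \<longleftrightarrow> sat M (s(n := a)) \<phi>"
      if "a \<in> universe M" for a
    proof -
      have "(\<lambda>k. h (s k))(n := h a) = (\<lambda>k. h ((s(n := a)) k))" by auto
      moreover have "range (s(n := a)) \<subseteq> universe M" using Exists.prems that by auto
      ultimately show ?thesis
        using Exists.IH[of "s(n := a)"] Exists.prems by (simp del: fun_upd_apply)
    qed
    then show ?case by (simp add: universe_image_structure)
  qed auto
qed

section \<open>Closed families of functions, limit ultrapowers and the theorem of Los\<close>

lemma tuples_imageE:
  assumes "ys \<in> tuples n (h ` C)"
  obtains gs where "ys = map h gs" "gs \<in> tuples n C"
proof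
  show "ys = map h (map (inv_into C h) ys)"
    using assms by (auto simp: tuples_def f_inv_into_f subset_iff intro!: map_idI[symmetric])
  show "map (inv_into C h) ys \<in> tuples n C"
    using assms by (auto simp: tuples_def subset_iff intro: inv_into_into)
qed

text \<open>Closure under arbitrary finitary operations, not just those of a language, so that
  Skolem functions are covered. The operation acts on lists to leave the arity free; the empty list
  yields the constants.\<close>

definition pointwise_closed :: "'a set \<Rightarrow> ('i \<Rightarrow> 'a) set \<Rightarrow> bool" where
  "pointwise_closed A C \<longleftrightarrow>
     (\<forall>f\<in>C. range f \<subseteq> A) \<and>
     (\<forall>fs g. set fs \<subseteq> C \<longrightarrow> (\<forall>x. g (map (\<lambda>f. f x) fs) \<in> A) \<longrightarrow>
        (\<lambda>x. g (map (\<lambda>f. f x) fs)) \<in> C)"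

lemma pointwise_closedD:
  assumes "pointwise_closed A C" "set fs \<subseteq> C" "\<And>x. g (map (\<lambda>f. f x) fs) \<in> A"
  shows "(\<lambda>x. g (map (\<lambda>f. f x) fs)) \<in> C"
  using assms by (auto simp: pointwise_closed_def)

lemma pointwise_closed_range: "pointwise_closed A C \<Longrightarrow> f \<in> C \<Longrightarrow> f x \<in> A"
  by (auto simp: pointwise_closed_def)

lemma pointwise_closed_const: "pointwise_closed A C \<Longrightarrow> a \<in> A \<Longrightarrow> (\<lambda>x. a) \<in> C"
  using pointwise_closedD[of A C "[]" "\<lambda>_. a"] by auto

text \<open>\<open>F\<close> has to decide only predicates of finitely many members of the ambient
  family \<open>E\<close>, so it may fall short of an ultrafilter. \<open>cls\<close> is any coding
  of the classes modulo \<open>F\<close>.\<close>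

locale limit_ultrapower =
  fixes L :: "('f, 'r) language" and M :: "('f, 'r, 'a) fo_structure"
    and F :: "'i filter" and E :: "('i \<Rightarrow> 'a) set" and cls :: "('i \<Rightarrow> 'a) \<Rightarrow> 'b"
  assumes M: "is_structure L M"
    and F: "F \<noteq> bot"
    and E: "pointwise_closed (universe M) E"
    and decides: "\<And>fs P. set fs \<subseteq> E \<Longrightarrow> eventually (\<lambda>x. P (map (\<lambda>f. f x) fs)) F \<or>
      eventually (\<lambda>x. \<not> P (map (\<lambda>f. f x) fs)) F"
    and cls_eq_iff: "\<And>f g. f \<in> E \<Longrightarrow> g \<in> E \<Longrightarrow> cls f = cls g \<longleftrightarrow> eventually (\<lambda>x. f x = g x) F"
begin

text \<open>Representatives are chosen in \<open>E\<close> rather than in \<open>C\<close>, so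
  function symbols have the same interpretation for all subfamilies and smaller families give
  substructures.\<close>

definition ultrapower :: "('i \<Rightarrow> 'a) set \<Rightarrow> ('f, 'r, 'b) fo_structure" where
  "ultrapower C =
     \<lparr>universe = cls ` C,
      fun_interp = (\<lambda>f ys. cls (\<lambda>x. fun_interp M f (map (\<lambda>y. inv_into E cls y x) ys))),
      rel_interp = (\<lambda>r. {ys \<in> tuples (rel_arity L r) (cls ` C).
        eventually (\<lambda>x. map (\<lambda>y. inv_into E cls y x) ys \<in> rel_interp M r) F})\<rparr>"

lemma universe_ultrapower [simp]: "universe (ultrapower C) = cls ` C"
  by (simp add: ultrapower_def)

text \<open>Each chosen representative agrees almost everywhere with the given function, and
  finitely many such conditions hold together. This makes the interpretations independent of the
  choice.\<close>

lemma eventually_representatives: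
  assumes "set gs \<subseteq> E"
  shows "eventually (\<lambda>x. map (\<lambda>y. inv_into E cls y x) (map cls gs) = map (\<lambda>g. g x) gs) F"
  using assms
proof (induction gs)
  case (Cons g gs)
  have "inv_into E cls (cls g) \<in> E" "cls (inv_into E cls (cls g)) = cls g"
    using Cons.prems inv_into_into[of "cls g" cls E] f_inv_into_f[of "cls g" cls E] by auto
  then have "eventually (\<lambda>x. inv_into E cls (cls g) x = g x) F"
    using cls_eq_iff Cons.prems by auto
  moreover have "eventually (\<lambda>x. map (\<lambda>y. inv_into E cls y x) (map cls gs) = map (\<lambda>g. g x) gs) F"
    using Cons by auto
  ultimately show ?case by eventually_elim auto
qed auto

lemma fun_interp_closed:
  assumes "pointwise_closed (universe M) C" "set gs \<subseteq> C" "f \<in> fun_syms L"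
    "length gs = fun_arity L f"
  shows "(\<lambda>x. fun_interp M f (map (\<lambda>g. g x) gs)) \<in> C"
proof (rule pointwise_closedD[OF assms(1,2)])
  fix x
  have "map (\<lambda>g. g x) gs \<in> tuples (fun_arity L f) (universe M)"
    using assms pointwise_closed_range[OF assms(1)] by (auto simp: tuples_def)
  then show "fun_interp M f (map (\<lambda>g. g x) gs) \<in> universe M"
    using M assms(3) by (auto simp: is_structure_def)
qed

lemma fun_interp_ultrapower:
  assumes "set gs \<subseteq> E" "f \<in> fun_syms L" "length gs = fun_arity L f"
  shows "fun_interp (ultrapower C) f (map cls gs) = cls (\<lambda>x. fun_interp M f (map (\<lambda>g. g x) gs))"
proof -
  let ?hs = "map (inv_into E cls) (map cls gs)"
  have hs: "set ?hs \<subseteq> E"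
    using assms(1) by (auto intro: inv_into_into)
  have "(\<lambda>x. fun_interp M f (map (\<lambda>g. g x) ?hs)) \<in> E"
    using assms by (intro fun_interp_closed[OF E hs]) auto
  moreover have "(\<lambda>x. fun_interp M f (map (\<lambda>g. g x) gs)) \<in> E"
    using assms by (intro fun_interp_closed[OF E]) auto
  moreover have "eventually (\<lambda>x. fun_interp M f (map (\<lambda>g. g x) ?hs) =
      fun_interp M f (map (\<lambda>g. g x) gs)) F"
    using eventually_representatives[OF assms(1)]
    by eventually_elim (simp add: comp_def cong: map_cong)
  ultimately have "cls (\<lambda>x. fun_interp M f (map (\<lambda>g. g x) ?hs)) =
      cls (\<lambda>x. fun_interp M f (map (\<lambda>g. g x) gs))"
    using cls_eq_iff by auto
  then show ?thesis by (simp add: ultrapower_def comp_def)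
qed

lemma rel_interp_ultrapower:
  assumes "set gs \<subseteq> C" "C \<subseteq> E" "length gs = rel_arity L r"
  shows "map cls gs \<in> rel_interp (ultrapower C) r \<longleftrightarrow>
    eventually (\<lambda>x. map (\<lambda>g. g x) gs \<in> rel_interp M r) F"
proof -
  have "map cls gs \<in> tuples (rel_arity L r) (cls ` C)"
    using assms by (auto simp: tuples_def)
  then have "map cls gs \<in> rel_interp (ultrapower C) r \<longleftrightarrow>
      eventually (\<lambda>x. map (\<lambda>y. inv_into E cls y x) (map cls gs) \<in> rel_interp M r) F"
    by (simp add: ultrapower_def)
  also have "\<dots> \<longleftrightarrow> eventually (\<lambda>x. map (\<lambda>g. g x) gs \<in> rel_interp M r) F"
    by (rule eventually_subst, rule eventually_mono[OF eventually_representatives])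
      (use assms in \<open>auto simp del: map_map\<close>)
  finally show ?thesis .
qed

lemma is_structure_ultrapower:
  assumes C: "pointwise_closed (universe M) C" "C \<subseteq> E"
  shows "is_structure L (ultrapower C)"
  unfolding is_structure_def
proof (intro conjI ballI)
  obtain a where "a \<in> universe M" using M by (auto simp: is_structure_def)
  then show "universe (ultrapower C) \<noteq> {}" using pointwise_closed_const[OF C(1)] by auto
next
  fix f ys assume f: "f \<in> fun_syms L" and "ys \<in> tuples (fun_arity L f) (universe (ultrapower C))"
  then obtain gs where gs: "ys = map cls gs" "gs \<in> tuples (fun_arity L f) C"
    using tuples_imageE[of ys "fun_arity L f" cls C] by auto
  then have "set gs \<subseteq> C" "length gs = fun_arity L f" by (auto simp: tuples_def)
  then show "fun_interp (ultrapower C) f ys \<in> universe (ultrapower C)"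
    using fun_interp_ultrapower[of gs f C] fun_interp_closed[OF C(1), of gs f] C(2) f gs(1) by auto
qed (auto simp: ultrapower_def)

lemma eval_term_ultrapower:
  assumes C: "pointwise_closed (universe M) C" "C \<subseteq> E"
    and "term_in L t" "range s \<subseteq> C"
  shows "(\<lambda>x. eval_term M (\<lambda>k. s k x) t) \<in> C \<and>
    eval_term (ultrapower C) (\<lambda>k. cls (s k)) t = cls (\<lambda>x. eval_term M (\<lambda>k. s k x) t)"
  using assms(3)
proof (induction t)
  case (Var n)
  then show ?case using assms(4) by auto
next
  case (App f ts)
  let ?gs = "map (\<lambda>t x. eval_term M (\<lambda>k. s k x) t) ts"
  have gs: "set ?gs \<subseteq> C" "length ?gs = fun_arity L f"
    and eq: "map (eval_term (ultrapower C) (\<lambda>k. cls (s k))) ts = map cls ?gs"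
    using App by auto
  have "(\<lambda>x. eval_term M (\<lambda>k. s k x) (App f ts)) = (\<lambda>x. fun_interp M f (map (\<lambda>g. g x) ?gs))"
    by (simp add: comp_def)
  then show ?case
    using fun_interp_closed[OF C(1) gs(1)] fun_interp_ultrapower[of ?gs f C] gs App.prems C(2) eq
    by (auto simp del: map_map)
qed

text \<open>Satisfaction depends on the first \<open>K\<close> values only, hence is a predicate of
  a finite list of members of \<open>E\<close>.\<close>

lemma sat_decides:
  assumes "range s \<subseteq> E"
  shows "eventually (\<lambda>x. sat M (\<lambda>k. s k x) \<phi>) F \<or> eventually (\<lambda>x. \<not> sat M (\<lambda>k. s k x) \<phi>) F"
proof -
  obtain K where K: "\<And>s s'. (\<forall>k<K. s k = s' k) \<Longrightarrow> sat M s \<phi> = sat M s' \<phi>"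
    using sat_finite_support[of M \<phi>] by blast
  have "sat M (\<lambda>k. s k x) \<phi> = sat M ((!) (map (\<lambda>f. f x) (map s [0..<K]))) \<phi>" for x
    by (rule K) auto
  then show ?thesis
    using decides[of "map s [0..<K]" "\<lambda>as. sat M ((!) as) \<phi>"] assms by auto
qed

text \<open>Los' theorem for a subfamily. Negation uses that \<open>F\<close> decides formulas; the
  existential quantifier uses that \<open>C\<close> contains a Skolem witness for parameters from
  \<open>C\<close>.\<close>

theorem sat_ultrapower_iff:
  assumes C: "pointwise_closed (universe M) C" "C \<subseteq> E"
    and "formula_in L \<phi>" "range s \<subseteq> C"
  shows "sat (ultrapower C) (\<lambda>k. cls (s k)) \<phi> \<longleftrightarrow> eventually (\<lambda>x. sat M (\<lambda>k. s k x) \<phi>) F"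
  using assms(3,4)
proof (induction \<phi> arbitrary: s)
  case (Equal t u)
  then show ?case
    using eval_term_ultrapower[OF C, of t s] eval_term_ultrapower[OF C, of u s] C(2)
    by (auto simp: cls_eq_iff subset_iff)
next
  case (Rel r ts)
  let ?gs = "map (\<lambda>t x. eval_term M (\<lambda>k. s k x) t) ts"
  have "set ?gs \<subseteq> C" "length ?gs = rel_arity L r"
    and "map (eval_term (ultrapower C) (\<lambda>k. cls (s k))) ts = map cls ?gs"
    using Rel eval_term_ultrapower[OF C] by auto
  then show ?case
    using rel_interp_ultrapower[of ?gs C r] C(2) by (simp add: comp_def del: map_eq_conv)
next
  case (Neg \<phi>)
  have "range s \<subseteq> E" using Neg.prems C(2) by auto
  then have "eventually (\<lambda>x. \<not> sat M (\<lambda>k. s k x) \<phi>) F \<longleftrightarrow> \<not> eventually (\<lambda>x. sat M (\<lambda>k. s k x) \<phi>) F"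
    using sat_decides[of s \<phi>] eventually_happens'[OF F eventually_conj] by blast
  then show ?case using Neg by simp
next
  case (Conj \<phi> \<psi>)
  then show ?case by (simp add: eventually_conj_iff)
next
  case (Exists n \<phi>)
  have IH: "sat (ultrapower C) ((\<lambda>k. cls (s k))(n := cls f)) \<phi> \<longleftrightarrow>
      eventually (\<lambda>x. sat M ((\<lambda>k. s k x)(n := f x)) \<phi>) F" if "f \<in> C" for f
  proof -
    have "(\<lambda>k. cls (s k))(n := cls f) = (\<lambda>k. cls ((s(n := f)) k))"
      "\<And>x. (\<lambda>k. s k x)(n := f x) = (\<lambda>k. (s(n := f)) k x)" by auto
    moreover have "range (s(n := f)) \<subseteq> C" using Exists.prems that by auto
    ultimately show ?thesis using Exists.IH[of "s(n := f)"] Exists.prems by simp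
  qed
  have "\<exists>f\<in>C. eventually (\<lambda>x. sat M ((\<lambda>k. s k x)(n := f x)) \<phi>) F"
    if ev: "eventually (\<lambda>x. \<exists>a\<in>universe M. sat M ((\<lambda>k. s k x)(n := a)) \<phi>) F"
  proof -
    obtain K where K: "\<And>s s'. (\<forall>k<K. s k = s' k) \<Longrightarrow> sat M s \<phi> = sat M s' \<phi>"
      using sat_finite_support[of M \<phi>] by blast
    obtain a0 where a0: "a0 \<in> universe M" using M by (auto simp: is_structure_def)
    let ?fs = "map s [0..<K]"
    \<comment> \<open>\<open>w\<close> is a Skolem function of the list of parameter values. The
      default \<open>a0\<close> keeps it in the universe at every point, as the closure of
      \<open>C\<close> demands, even where no witness exists.\<close>
    define w where "w as = (if \<exists>a\<in>universe M. sat M (((!) as)(n := a)) \<phi>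
      then SOME a. a \<in> universe M \<and> sat M (((!) as)(n := a)) \<phi> else a0)" for as
    have w: "w as \<in> universe M" for as
      unfolding w_def using a0 by (auto intro: someI2_ex)
    have w_sat: "sat M (((!) as)(n := w as)) \<phi>"
      if "\<exists>a\<in>universe M. sat M (((!) as)(n := a)) \<phi>" for as
      unfolding w_def using that by (auto intro: someI2_ex)
    have eq: "sat M ((\<lambda>k. s k x)(n := a)) \<phi> = sat M (((!) (map (\<lambda>f. f x) ?fs))(n := a)) \<phi>" for x a
      by (rule K) auto
    have "(\<lambda>x. w (map (\<lambda>f. f x) ?fs)) \<in> C"
      using Exists.prems w by (intro pointwise_closedD[OF C(1)]) auto
    moreover have "eventually (\<lambda>x. sat M ((\<lambda>k. s k x)(n := w (map (\<lambda>f. f x) ?fs))) \<phi>) F"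
      using ev by (rule eventually_mono) (simp add: eq w_sat del: map_map)
    ultimately show ?thesis by (intro bexI)
  qed
  moreover have "eventually (\<lambda>x. \<exists>a\<in>universe M. sat M ((\<lambda>k. s k x)(n := a)) \<phi>) F"
    if "f \<in> C" "eventually (\<lambda>x. sat M ((\<lambda>k. s k x)(n := f x)) \<phi>) F" for f
    using that(2) by (rule eventually_mono) (use pointwise_closed_range[OF C(1) that(1)] in blast)
  ultimately show ?case using IH by (auto simp del: fun_upd_apply)
qed

text \<open>For parameters represented in \<open>D\<close>, Los' theorem reduces truth in either
  structure to the same condition on \<open>F\<close>.\<close>

lemma elementary_extension_ultrapower:
  assumes C: "pointwise_closed (universe M) C" "C \<subseteq> E"
    and D: "pointwise_closed (universe M) D" "D \<subseteq> C"
  shows "elementary_extension L (ultrapower C) (ultrapower D)"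
  unfolding elementary_extension_def substructure_def
proof (intro conjI allI impI ballI)
  have DE: "D \<subseteq> E" using C D by auto
  show "is_structure L (ultrapower C)" "is_structure L (ultrapower D)"
    using is_structure_ultrapower C D DE by auto
  show "universe (ultrapower D) \<subseteq> universe (ultrapower C)" using D by auto
  show "fun_interp (ultrapower D) f xs = fun_interp (ultrapower C) f xs" for f xs
    by (simp add: ultrapower_def)
  show "rel_interp (ultrapower D) r = rel_interp (ultrapower C) r \<inter> tuples (rel_arity L r) (universe (ultrapower D))"
    for r
  proof -
    have "cls ` D \<subseteq> cls ` C" using D by auto
    then show ?thesis by (auto simp: ultrapower_def tuples_def)
  qed
  fix \<phi> and s :: "nat \<Rightarrow> 'b"
  assume \<phi>: "formula_in L \<phi>" and "range s \<subseteq> universe (ultrapower D)"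
  then have "\<forall>k. \<exists>f\<in>D. s k = cls f" by auto
  then obtain s' where "\<forall>k. s' k \<in> D \<and> s k = cls (s' k)" by metis
  then have "range s' \<subseteq> D" "s = (\<lambda>k. cls (s' k))" by auto
  then show "sat (ultrapower D) s \<phi> \<longleftrightarrow> sat (ultrapower C) s \<phi>"
    using sat_ultrapower_iff[OF C \<phi>, of s'] sat_ultrapower_iff[OF D(1) DE \<phi>, of s'] D by auto
qed

text \<open>Elements of \<open>M\<close> are represented by constant functions, for which the
  condition in Los' theorem is constant; as \<open>F\<close> is nontrivial, it amounts to truth in
  \<open>M\<close>.\<close>

lemma elementary_extension_image_structure:
  assumes C: "pointwise_closed (universe M) C" "C \<subseteq> E"
    and h: "\<And>a. a \<in> universe M \<Longrightarrow> cls (\<lambda>_. a) = h a"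
  shows "elementary_extension L (ultrapower C) (image_structure h M)"
  unfolding elementary_extension_def substructure_def
proof (intro conjI allI impI ballI)
  note const = pointwise_closed_const[OF C(1)]
  have inj: "inj_on h (universe M)"
  proof (rule inj_onI)
    fix a b assume "a \<in> universe M" "b \<in> universe M" "h a = h b"
    then have "eventually (\<lambda>x. a = b) F"
      using cls_eq_iff[of "\<lambda>_. a" "\<lambda>_. b"] h const C(2) by auto
    then show "a = b" using F by simp
  qed
  have map_h: "map h as = map cls (map (\<lambda>a _. a) as)" if "set as \<subseteq> universe M" for as
    using that h by auto
  show "is_structure L (ultrapower C)" "is_structure L (image_structure h M)"
    using is_structure_ultrapower C is_structure_image_structure[OF inj M] by auto
  show "universe (image_structure h M) \<subseteq> universe (ultrapower C)"
    using const h by (force simp: universe_image_structure)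
  show "fun_interp (image_structure h M) f ys = fun_interp (ultrapower C) f ys"
    if f: "f \<in> fun_syms L" and ys: "ys \<in> tuples (fun_arity L f) (universe (image_structure h M))" for f ys
  proof -
    obtain as where as: "ys = map h as" "as \<in> tuples (fun_arity L f) (universe M)"
      using tuples_imageE ys unfolding universe_image_structure by blast
    then have "set as \<subseteq> universe M" "length as = fun_arity L f" by (auto simp: tuples_def)
    moreover have "set (map (\<lambda>a _. a) as) \<subseteq> E"
      using \<open>set as \<subseteq> universe M\<close> const C(2) by auto
    ultimately have "fun_interp (ultrapower C) f ys = cls (\<lambda>_. fun_interp M f as)"
      using as fun_interp_ultrapower[of "map (\<lambda>a _. a) as" f C] f map_h by (simp add: comp_def)
    also have "\<dots> = h (fun_interp M f as)"
      using M f as by (intro h) (auto simp: is_structure_def)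
    finally show ?thesis
      using fun_interp_image_structure[OF inj \<open>set as \<subseteq> universe M\<close>] as by simp
  qed
  show "rel_interp (image_structure h M) r =
      rel_interp (ultrapower C) r \<inter> tuples (rel_arity L r) (universe (image_structure h M))"
    if r: "r \<in> rel_syms L" for r
  proof -
    have "ys \<in> rel_interp (image_structure h M) r \<longleftrightarrow> ys \<in> rel_interp (ultrapower C) r"
      if "ys \<in> tuples (rel_arity L r) (universe (image_structure h M))" for ys
    proof -
      obtain as where as: "ys = map h as" "as \<in> tuples (rel_arity L r) (universe M)"
        using tuples_imageE \<open>ys \<in> _\<close> unfolding universe_image_structure by blast
      then have "set as \<subseteq> universe M" "length as = rel_arity L r" by (auto simp: tuples_def)
      moreover have "set (map (\<lambda>a _. a) as) \<subseteq> C"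
        using \<open>set as \<subseteq> universe M\<close> const by auto
      ultimately have "ys \<in> rel_interp (ultrapower C) r \<longleftrightarrow> as \<in> rel_interp M r"
        using as rel_interp_ultrapower[of "map (\<lambda>a _. a) as" C r] C(2) map_h F
        by (simp add: comp_def)
      then show ?thesis
        using rel_interp_image_structure[OF inj M r \<open>set as \<subseteq> universe M\<close>] as by simp
    qed
    moreover have "rel_interp (image_structure h M) r \<subseteq>
        tuples (rel_arity L r) (universe (image_structure h M))"
      using is_structure_image_structure[OF inj M] r by (auto simp: is_structure_def)
    ultimately show ?thesis by blast
  qed
  fix \<phi> and s :: "nat \<Rightarrow> 'b"
  assume \<phi>: "formula_in L \<phi>" and "range s \<subseteq> universe (image_structure h M)"
  then have "\<forall>k. \<exists>a\<in>universe M. s k = h a" by (auto simp: universe_image_structure)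
  then obtain s' where s': "\<forall>k. s' k \<in> universe M \<and> s k = h (s' k)" by metis
  then have "s = (\<lambda>k. cls (\<lambda>_. s' k))" "range (\<lambda>k _. s' k) \<subseteq> C" using h const by auto
  then have "sat (ultrapower C) s \<phi> \<longleftrightarrow> sat M s' \<phi>"
    using sat_ultrapower_iff[OF C \<phi>, of "\<lambda>k _. s' k"] F by simp
  moreover have "range s' \<subseteq> universe M" "s = (\<lambda>k. h (s' k))" using s' by auto
  ultimately show "sat (image_structure h M) s \<phi> \<longleftrightarrow> sat (ultrapower C) s \<phi>"
    using sat_image_structure[OF inj M \<phi>, of s'] by simp
qed

end

section \<open>The descending chain\<close>

text \<open>
  A function of finite support is determined by its values on finite sequences, hence by a subset of
  \<open>nat list \<times> 'a\<close>, which has the cardinality of \<open>'a\<close>. This is what makes the extensions fit into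
  the type \<open>'a + 'a set\<close>.
\<close>
lemma finite_support_functions_inject:
  includes cardinal_syntax
  assumes "infinite (UNIV :: 'a set)"
  obtains J :: "((nat \<Rightarrow> nat) \<Rightarrow> 'a) \<Rightarrow> 'a set"
  where "inj_on J {f. \<exists>m. determined_by f {..<m}}"
proof -
  obtain e0 :: "nat \<Rightarrow> 'a" where "inj e0"
    using infinite_countable_subset[OF assms] by blast
  then have "inj (e0 \<circ> (to_nat :: nat list \<Rightarrow> nat))"
    by (intro inj_compose inj_to_nat)
  then have "|UNIV :: nat list set| \<le>o |UNIV :: 'a set|"
    by (rule card_of_ordLeqI) auto
  then have "|(UNIV :: nat list set) \<times> (UNIV :: 'a set)| =o |UNIV :: 'a set|"
    using card_of_Times_infinite[OF assms] by blast
  then have "|(UNIV :: nat list set) \<times> (UNIV :: 'a set)| \<le>o |UNIV :: 'a set|"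
    by (rule ordIso_imp_ordLeq)
  then obtain e :: "nat list \<times> 'a \<Rightarrow> 'a" where e: "inj e"
    unfolding card_of_ordLeq[symmetric] by auto
  \<comment> \<open>Padding with 0 turns a list into a sequence. A function determined by
    coordinates below \<open>m\<close> is recovered from lists of length at least \<open>m\<close>;
    length \<open>max m n\<close> serves both functions compared below.\<close>
  define val where "val f xs = f (\<lambda>i. if i < length xs then xs ! i else 0)"
    for f :: "(nat \<Rightarrow> nat) \<Rightarrow> 'a" and xs
  have "inj_on (\<lambda>f. e ` range (\<lambda>xs. (xs, val f xs))) {f. \<exists>m. determined_by f {..<m}}"
  proof (rule inj_onI, clarify)
    fix f g m n
    assume f: "determined_by f {..<m}" and g: "determined_by g {..<n}"
      and "e ` range (\<lambda>xs. (xs, val f xs)) = e ` range (\<lambda>xs. (xs, val g xs))"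
    then have "range (\<lambda>xs. (xs, val f xs)) = range (\<lambda>xs. (xs, val g xs))"
      using e by (simp add: inj_image_eq_iff)
    then have val: "val f xs = val g xs" for xs by (auto simp: set_eq_iff image_iff)
    show "f = g"
    proof
      fix x :: "nat \<Rightarrow> nat"
      let ?xs = "map x [0..<max m n]"
      have "f x = val f ?xs" unfolding val_def by (rule determined_byD[OF f]) auto
      moreover have "g x = val g ?xs" unfolding val_def by (rule determined_byD[OF g]) auto
      ultimately show "f x = g x" using val by simp
    qed
  qed
  then show ?thesis by (rule that)
qed

text \<open>Classes of constants get the code \<open>Inl a\<close>, so that the copy of
  \<open>M\<close> along \<open>Inl\<close> sits inside the ultrapowers; any other class is coded by
  the \<open>J\<close>-value of a chosen representative.\<close>

lemma class_coding:
  fixes F :: "'i filter" and J :: "('i \<Rightarrow> 'a) \<Rightarrow> 'c"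
  assumes "F \<noteq> bot" and J: "inj_on J E"
  obtains cls :: "('i \<Rightarrow> 'a) \<Rightarrow> 'a + 'c"
  where "\<forall>f\<in>E. \<forall>g\<in>E. cls f = cls g \<longleftrightarrow> eventually (\<lambda>x. f x = g x) F"
    and "\<forall>a. cls (\<lambda>_. a) = Inl a"
proof -
  define eqv where "eqv f g \<longleftrightarrow> eventually (\<lambda>x. f x = g x) F" for f g :: "'i \<Rightarrow> 'a"
  have refl: "eqv f f" for f by (simp add: eqv_def)
  have sym: "eqv f g \<Longrightarrow> eqv g f" for f g by (simp add: eqv_def eq_commute)
  have trans: "eqv f g \<Longrightarrow> eqv g h \<Longrightarrow> eqv f h" for f g h
    unfolding eqv_def by (auto elim: eventually_elim2)
  \<comment> \<open>Both choices depend only on the class of \<open>f\<close>. The second stays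
    inside \<open>E\<close>, where \<open>J\<close> is injective.\<close>
  define cls where "cls f = (if \<exists>a. eqv f (\<lambda>_. a) then Inl (SOME a. eqv f (\<lambda>_. a))
    else Inr (J (SOME g. g \<in> E \<and> eqv f g)))" for f
  have cls_Inl: "eqv f (\<lambda>_. a)" if "cls f = Inl a" for f a
    using that unfolding cls_def by (auto split: if_splits intro: someI)
  have cls_Inr: "\<exists>g\<in>E. eqv f g \<and> c = J g" if "cls f = Inr c" "f \<in> E" for f c
  proof -
    have "(SOME g. g \<in> E \<and> eqv f g) \<in> E \<and> eqv f (SOME g. g \<in> E \<and> eqv f g)"
      by (rule someI[of _ f]) (simp add: that refl)
    then show ?thesis using that(1) unfolding cls_def by (auto split: if_splits)
  qed
  show ?thesis
  proof (rule that, safe del: iffI)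
    fix f g assume fg: "f \<in> E" "g \<in> E"
    show "cls f = cls g \<longleftrightarrow> eventually (\<lambda>x. f x = g x) F"
      unfolding eqv_def[symmetric]
    proof
      assume eq: "cls f = cls g"
      show "eqv f g"
      proof (cases "cls g")
        case (Inl a)
        then show ?thesis using eq cls_Inl sym trans by metis
      next
        case (Inr c)
        then obtain r r' where "r \<in> E" "r' \<in> E" "eqv f r" "eqv g r'" "J r = J r'"
          using eq fg cls_Inr by metis
        then show ?thesis using inj_onD[OF J, of r r'] sym trans by blast
      qed
    next
      assume "eqv f g"
      then have "eqv f h \<longleftrightarrow> eqv g h" for h using sym trans by blast
      then show "cls f = cls g" by (simp add: cls_def)
    qed
  next
    fix a
    have "eqv (\<lambda>_. a) (\<lambda>_. b) \<longleftrightarrow> b = a" for b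
      using assms(1) by (auto simp: eqv_def)
    then show "cls (\<lambda>_. a) = Inl a" by (simp add: cls_def)
  qed
qed

text \<open>Finitely many upper bounds have a maximum, while the lower bound \<open>i\<close> is
  kept; this makes each level of the chain closed.\<close>

lemma common_support:
  fixes i :: nat
  assumes "\<forall>f\<in>set fs. \<exists>m. determined_by f {i..<m}"
  shows "\<exists>m. determined_by (\<lambda>x. map (\<lambda>f. f x) fs) {i..<m}"
  using assms
proof (induction fs)
  case Nil
  then show ?case by (simp add: determined_by_def)
next
  case (Cons f fs)
  then obtain m n where "determined_by f {i..<m}" "determined_by (\<lambda>x. map (\<lambda>f. f x) fs) {i..<n}"
    by auto
  then have "determined_by f {i..<max m n}" "determined_by (\<lambda>x. map (\<lambda>f. f x) fs) {i..<max m n}"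
    by (auto elim!: determined_by_mono)
  then show ?case
    by (intro exI[of _ "max m n"]) (simp add: determined_by_def)
qed

theorem theorem2p2:
  fixes L :: "('f, 'r) language" and M :: "('f, 'r, 'a) fo_structure"
  assumes "is_structure L M" and "infinite (universe M)"
  shows "\<exists>N :: nat \<Rightarrow> ('f, 'r, 'a + 'a set) fo_structure.
           (\<forall>i. proper_elementary_extension L (N i) (image_structure Inl M)) \<and>
           (\<Inter>i. universe (N i)) = universe (image_structure Inl M) \<and>
           (\<forall>i. proper_elementary_extension L (N i) (N (Suc i)))"
proof -
  obtain U :: "nat filter" where U: "U \<noteq> bot" "U \<le> sequentially"
    "\<And>P. eventually P U \<or> eventually (\<lambda>x. \<not> P x) U"
    using ultrafilter_exists[of sequentially] by auto
  define F where "F = iterated_filter U"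
  have F: "F \<noteq> bot" unfolding F_def by (rule iterated_filter_neq_bot[OF U(1)])
  \<comment> \<open>For \<open>m \<le> i\<close> the interval is empty, so every level contains the
    constants.\<close>
  define C where "C i = {f :: (nat \<Rightarrow> nat) \<Rightarrow> 'a. range f \<subseteq> universe M \<and> (\<exists>m. determined_by f {i..<m})}"
    for i :: nat
  have C_mono: "C j \<subseteq> C i" if "i \<le> j" for i j
    using that unfolding C_def by (fastforce intro: determined_by_mono)
  have C_closed: "pointwise_closed (universe M) (C i)" for i
    unfolding pointwise_closed_def
  proof (intro conjI ballI allI impI)
    fix fs and g :: "'a list \<Rightarrow> 'a"
    assume fs: "set fs \<subseteq> C i" and g: "\<forall>x. g (map (\<lambda>f. f x) fs) \<in> universe M"
    obtain m where "determined_by (\<lambda>x. map (\<lambda>f. f x) fs) {i..<m}"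
      using common_support[of fs i] fs unfolding C_def by blast
    then have "determined_by (\<lambda>x. g (map (\<lambda>f. f x) fs)) {i..<m}"
      unfolding determined_by_def by metis
    then show "(\<lambda>x. g (map (\<lambda>f. f x) fs)) \<in> C i"
      using g by (auto simp: C_def)
  qed (auto simp: C_def)
  have "infinite (UNIV :: 'a set)"
    using assms(2) by (meson finite_subset subset_UNIV)
  then obtain J :: "((nat \<Rightarrow> nat) \<Rightarrow> 'a) \<Rightarrow> 'a set"
    where "inj_on J {f. \<exists>m. determined_by f {..<m}}"
    by (rule finite_support_functions_inject)
  then have "inj_on J (C 0)"
    by (rule inj_on_subset) (auto simp: C_def atLeast0LessThan)
  then obtain cls :: "((nat \<Rightarrow> nat) \<Rightarrow> 'a) \<Rightarrow> 'a + 'a set"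
    where "\<forall>f\<in>C 0. \<forall>g\<in>C 0. cls f = cls g \<longleftrightarrow> eventually (\<lambda>x. f x = g x) F"
      and "\<forall>a. cls (\<lambda>_. a) = Inl a"
    by (rule class_coding[OF F])
  then have cls: "\<And>f g. f \<in> C 0 \<Longrightarrow> g \<in> C 0 \<Longrightarrow> cls f = cls g \<longleftrightarrow> eventually (\<lambda>x. f x = g x) F"
    and cls_const: "\<And>a. cls (\<lambda>_. a) = Inl a"
    by blast+
  interpret limit_ultrapower L M F "C 0" cls
  proof
    fix fs and P :: "'a list \<Rightarrow> bool" assume "set fs \<subseteq> C 0"
    then obtain m where "determined_by (\<lambda>x. map (\<lambda>f. f x) fs) {0..<m}"
      using common_support[of fs 0] unfolding C_def by blast
    then have "determined_by (\<lambda>x. P (map (\<lambda>f. f x) fs)) {..<m}"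
      unfolding determined_by_def atLeast0LessThan by metis
    then show "eventually (\<lambda>x. P (map (\<lambda>f. f x) fs)) F \<or>
        eventually (\<lambda>x. \<not> P (map (\<lambda>f. f x) fs)) F"
      unfolding F_def using iterated_filter_decides[OF U(3)] by auto
  qed (fact assms F C_closed cls)+
  have C0: "C i \<subseteq> C 0" for i by (rule C_mono) simp
  have const: "(\<lambda>_. a) \<in> C i" if "a \<in> universe M" for a i
    using pointwise_closed_const[OF C_closed that] .
  \<comment> \<open>An element represented both below coordinate \<open>n\<close> and from
    \<open>n\<close> on has a constant representative.\<close>
  have disjoint: "\<exists>y. eventually (\<lambda>x. g x = f y) F"
    if "f \<in> C 0" "determined_by f {..<n}" "g \<in> C n" "cls f = cls g" for f g n
  proof -
    have "eventually (\<lambda>x. f x = g x) (iterated_filter U)"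
      using cls[of f g] that C0 by (auto simp: F_def)
    moreover have "determined_by g {n..}"
      using that(3) by (auto simp: C_def elim!: determined_by_mono)
    ultimately show ?thesis
      unfolding F_def by (rule iterated_filter_disjoint_supports[OF U(1) _ that(2)])
  qed
  have proper: "cls ` C (Suc i) \<noteq> cls ` C i" for i
  proof -
    obtain e :: "nat \<Rightarrow> 'a" where e: "inj e" "range e \<subseteq> universe M"
      using infinite_countable_subset[OF assms(2)] by blast
    \<comment> \<open>The \<open>i\<close>-th coordinate, moved into \<open>M\<close> by an
      injection of the natural numbers, is new at level \<open>i\<close>.\<close>
    let ?f = "\<lambda>x :: nat \<Rightarrow> nat. e (x i)"
    have "determined_by ?f {i..<Suc i}" by (auto simp: determined_by_def)
    then have f: "?f \<in> C i" using e(2) unfolding C_def by blast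
    have "cls ?f \<notin> cls ` C (Suc i)"
    proof
      assume "cls ?f \<in> cls ` C (Suc i)"
      then obtain g where g: "g \<in> C (Suc i)" "cls ?f = cls g" by auto
      \<comment> \<open>Its support \<open>{i}\<close> lies below \<open>Suc i\<close>, whereas
        \<open>g\<close> depends only on coordinates from \<open>Suc i\<close> on.\<close>
      moreover have "determined_by ?f {..<Suc i}" by (auto simp: determined_by_def)
      ultimately obtain y where "eventually (\<lambda>x. g x = e (y i)) F"
        using disjoint[of ?f "Suc i" g] f C0 by blast
      moreover have "eventually (\<lambda>x. ?f x = g x) F" using cls[of ?f g] f g C0 by blast
      ultimately have "eventually (\<lambda>x. x i = y i) F"
        by eventually_elim (use e(1) in \<open>auto dest: injD\<close>)
      \<comment> \<open>Here \<open>U\<close> being nonprincipal enters.\<close>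
      moreover have "eventually (\<lambda>a. a \<noteq> y i) U"
        using U(2) eventually_gt_at_top[of "y i"] by (auto elim!: filter_leD eventually_mono)
      ultimately show False
        using iterated_filter_coordinate_not_const[OF U(1)] by (auto simp: F_def)
    qed
    then show ?thesis using f by blast
  qed
  have image: "universe (image_structure Inl M) \<subseteq> cls ` C i" for i
    using const cls_const[symmetric] by (auto simp: universe_image_structure)
  have "proper_elementary_extension L (ultrapower (C i)) (ultrapower (C (Suc i)))" for i
    unfolding proper_elementary_extension_def
    using elementary_extension_ultrapower[OF C_closed C0 C_closed C_mono] proper by auto
  moreover have "proper_elementary_extension L (ultrapower (C i)) (image_structure Inl M)" for i
    unfolding proper_elementary_extension_def
  proof
    show "elementary_extension L (ultrapower (C i)) (image_structure Inl M)"
      using elementary_extension_image_structure[OF C_closed C0] cls_const by blast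
    have "cls ` C (Suc i) \<subseteq> cls ` C i" using C_mono[of i "Suc i"] by auto
    then show "universe (image_structure Inl M) \<noteq> universe (ultrapower (C i))"
      using proper[of i] image[of "Suc i"] by auto
  qed
  moreover have "(\<Inter>i. cls ` C i) \<subseteq> universe (image_structure Inl M)"
  proof
    fix c assume c: "c \<in> (\<Inter>i. cls ` C i)"
    then obtain f where f: "f \<in> C 0" "c = cls f" by blast
    \<comment> \<open>The support bound of one representative selects the level at which to take a
      second one with disjoint support.\<close>
    then obtain n where n: "determined_by f {..<n}" by (auto simp: C_def atLeast0LessThan)
    obtain g where g: "g \<in> C n" "c = cls g" using c by blast
    obtain y where "eventually (\<lambda>x. g x = f y) F" using disjoint[OF f(1) n g(1)] f g by auto
    moreover have y: "f y \<in> universe M" using f by (auto simp: C_def)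
    ultimately have "cls g = cls (\<lambda>_. f y)" using cls[of g "\<lambda>_. f y"] const g C0 by blast
    then show "c \<in> universe (image_structure Inl M)"
      using g y cls_const by (auto simp: universe_image_structure)
  qed
  then have "(\<Inter>i. universe (ultrapower (C i))) = universe (image_structure Inl M)"
    using image unfolding universe_ultrapower by blast
  ultimately show ?thesis by (intro exI[of _ "\<lambda>i. ultrapower (C i)"]) blast
qed

end
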